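(* Let $G \in \mathscr{S}$. For each $\alpha \in \mathcal{LN}(G)$, there exist $g_1, \dots, g_n \in G$ such that $g_1\alpha \vee \dots \vee g_n\alpha$ is fixed by $G$.
   Context: $\mathscr{S}$ is the class of non-discrete, compactly generated, topologically simple, totally disconnected locally compact groups (topologically simple: non-trivial, and the only closed normal subgroups are $\{1\}$ and the whole group). Let $G$ be a totally disconnected locally compact group. A subgroup of $G$ is locally normal if its normaliser in $G$ is open. The structure lattice $\mathcal{LN}(G)$ is the set of closed locally normal subgroups of $G$ modulo the equivalence relation $H \sim K$ iff $H \cap K$ is open in both $H$ and $K$; the class of $H$ is written $[H]$. It is a lattice (with join $\vee$ and meet $\wedge$) for the order $\alpha \le \beta$ iff there are $H \in \alpha$, $K \in \beta$ with $H \le K$. $G$ acts on $\mathcal{LN}(G)$ by conjugation: $g[H] = [gHg^{-1}]$. *)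

theory Defs
  imports "HOL-Analysis.Analysis" "HOL-Algebra.Algebra"
begin

section \<open>Totally disconnected locally compact groups\<close>

locale topological_group = group G for G (structure) +
  fixes T :: "'a topology"
  assumes topspace_eq: "topspace T = carrier G"
    and continuous_mult: "continuous_map (prod_topology T T) T (\<lambda>(x, y). x \<otimes> y)"
    and continuous_inv: "continuous_map T T (\<lambda>x. inv x)"

locale tdlc_group = topological_group +
  assumes Hausdorff: "Hausdorff_space T"
    and locally_compact: "locally_compact_space T"
    and totally_disconnected:
      "\<And>x. x \<in> carrier G \<Longrightarrow> connected_component_of_set T x = {x}"

definition compactly_generated :: "('a, 'b) monoid_scheme \<Rightarrow> 'a topology \<Rightarrow> bool"
  where "compactly_generated G T \<longleftrightarrow> (\<exists>K. compactin T K \<and> generate G K = carrier G)"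

definition topologically_simple :: "('a, 'b) monoid_scheme \<Rightarrow> 'a topology \<Rightarrow> bool"
  where "topologically_simple G T \<longleftrightarrow>
    carrier G \<noteq> {\<one>\<^bsub>G\<^esub>} \<and>
    (\<forall>N. N \<lhd> G \<and> closedin T N \<longrightarrow> N = {\<one>\<^bsub>G\<^esub>} \<or> N = carrier G)"

definition class_S :: "('a, 'b) monoid_scheme \<Rightarrow> 'a topology \<Rightarrow> bool"
  where "class_S G T \<longleftrightarrow>
    tdlc_group G T \<and> T \<noteq> discrete_topology (carrier G) \<and>
    compactly_generated G T \<and> topologically_simple G T"


section \<open>The structure lattice\<close>

definition locally_normal :: "('a, 'b) monoid_scheme \<Rightarrow> 'a topology \<Rightarrow> 'a set \<Rightarrow> bool"
  where "locally_normal G T H \<longleftrightarrow> subgroup H G \<and> openin T (normalizer G H)"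

definition closed_locally_normal :: "('a, 'b) monoid_scheme \<Rightarrow> 'a topology \<Rightarrow> 'a set set"
  where "closed_locally_normal G T = {H. closedin T H \<and> locally_normal G T H}"

definition loc_equiv :: "('a, 'b) monoid_scheme \<Rightarrow> 'a topology \<Rightarrow> ('a set \<times> 'a set) set"
  where "loc_equiv G T = {(H, K).
    H \<in> closed_locally_normal G T \<and> K \<in> closed_locally_normal G T \<and>
    openin (subtopology T H) (H \<inter> K) \<and> openin (subtopology T K) (H \<inter> K)}"

definition structure_lattice :: "('a, 'b) monoid_scheme \<Rightarrow> 'a topology \<Rightarrow> 'a set set gorder"
  where "structure_lattice G T =
    \<lparr>carrier = closed_locally_normal G T // loc_equiv G T,
     eq = (=),
     le = (\<lambda>\<alpha> \<beta>. \<exists>H\<in>\<alpha>. \<exists>K\<in>\<beta>. H \<subseteq> K)\<rparr>"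

text \<open>Joins are the library's \<^const>\<open>Lattice.sup\<close> for this order: least upper bounds, unique
  when they exist by \<open>partial_order_structure_lattice\<close>.\<close>

definition conj_subset :: "('a, 'b) monoid_scheme \<Rightarrow> 'a \<Rightarrow> 'a set \<Rightarrow> 'a set"
  where "conj_subset G g H = g <#\<^bsub>G\<^esub> H #>\<^bsub>G\<^esub> inv\<^bsub>G\<^esub> g"

text \<open>The union below is over a single class: by \<open>conj_class_eq\<close>, the definition is the
  lifting of \<^const>\<open>conj_subset\<close> to classes.\<close>

definition conj_class ::
    "('a, 'b) monoid_scheme \<Rightarrow> 'a topology \<Rightarrow> 'a \<Rightarrow> 'a set set \<Rightarrow> 'a set set"
  where "conj_class G T g \<alpha> = (\<Union>H\<in>\<alpha>. loc_equiv G T `` {conj_subset G g H})"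


section \<open>Well-definedness\<close>

context topological_group
begin

lemma continuous_translation:
  assumes "a \<in> carrier G"
  shows "continuous_map T T (\<lambda>x. a \<otimes> x)" "continuous_map T T (\<lambda>x. x \<otimes> a)"
proof -
  have "continuous_map T (prod_topology T T) (\<lambda>x. (a, x))"
    "continuous_map T (prod_topology T T) (\<lambda>x. (x, a))"
    using assms by (auto simp: continuous_map_pairedI topspace_eq)
  from this[THEN continuous_map_compose, OF continuous_mult]
  show "continuous_map T T (\<lambda>x. a \<otimes> x)" "continuous_map T T (\<lambda>x. x \<otimes> a)"
    by (simp_all add: o_def)
qed

lemma continuous_conj:
  assumes "a \<in> carrier G"
  shows "continuous_map T T (\<lambda>x. a \<otimes> x \<otimes> inv a)"
  using continuous_map_compose[OF continuous_translation(1)[OF assms]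
      continuous_translation(2)[of "inv a"]] assms
  by (simp add: o_def)

lemma openin_subgroupI:
  assumes H: "subgroup H G" and A: "subgroup A G" "A \<subseteq> H"
    and B: "openin (subtopology T H) B" "B \<subseteq> A" "\<one> \<in> B"
  shows "openin (subtopology T H) A"
proof (subst openin_subopen, intro ballI)
  fix a assume a: "a \<in> A"
  have HG: "H \<subseteq> carrier G" using H by (rule subgroup.subset)
  have aH: "a \<in> H" and aG: "a \<in> carrier G" using a A HG by auto
  let ?f = "\<lambda>x. inv a \<otimes> x"
  have "continuous_map (subtopology T H) (subtopology T H) ?f"
    using continuous_translation(1)[of "inv a"] aG aH H
    by (auto simp: continuous_map_in_subtopology continuous_map_from_subtopology topspace_eq
        subgroup.m_closed subgroup.m_inv_closed)
  then have "openin (subtopology T H) {x \<in> topspace (subtopology T H). ?f x \<in> B}"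
    using B(1) openin_continuous_map_preimage by blast
  moreover have "topspace (subtopology T H) = H"
    using HG topspace_eq by auto
  ultimately have op: "openin (subtopology T H) {x \<in> H. ?f x \<in> B}" by (simp only:)
  have "{x \<in> H. ?f x \<in> B} \<subseteq> A"
  proof clarify
    fix x assume x: "x \<in> H" "inv a \<otimes> x \<in> B"
    have "a \<otimes> (inv a \<otimes> x) \<in> A"
      using subgroup.m_closed[OF A(1) a] B(2) x(2) by blast
    then show "x \<in> A" using x(1) aG HG by (simp add: subset_eq flip: m_assoc)
  qed
  moreover have "a \<in> {x \<in> H. ?f x \<in> B}" using aH aG B(3) by simp
  ultimately show "\<exists>U. openin (subtopology T H) U \<and> a \<in> U \<and> U \<subseteq> A" using op by blast
qed

lemma clnD:
  assumes "H \<in> closed_locally_normal G T"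
  shows "subgroup H G" "closedin T H" "openin T (normalizer G H)" "H \<subseteq> carrier G"
  using assms subgroup.subset by (auto simp: closed_locally_normal_def locally_normal_def)

lemma equiv_loc_equiv: "equiv (closed_locally_normal G T) (loc_equiv G T)"
proof (rule equivI)
  show "loc_equiv G T \<subseteq> closed_locally_normal G T \<times> closed_locally_normal G T"
    by (auto simp: loc_equiv_def)
  show "refl_on (closed_locally_normal G T) (loc_equiv G T)"
    using clnD(4) by (auto simp: refl_on_def loc_equiv_def openin_subtopology_self
        openin_subtopology_refl topspace_eq)
  show "sym (loc_equiv G T)"
    by (auto simp: sym_def loc_equiv_def Int_commute)
  have *: "openin (subtopology T H) (H \<inter> L)"
    if c: "H \<in> closed_locally_normal G T" "K \<in> closed_locally_normal G T"
      "L \<in> closed_locally_normal G T"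
      and o: "openin (subtopology T H) (H \<inter> K)" "openin (subtopology T K) (K \<inter> L)"
    for H K L
  proof (rule openin_subgroupI)
    show "subgroup H G" "subgroup (H \<inter> L) G" "H \<inter> L \<subseteq> H"
      using c clnD(1) subgroups_Inter_pair by auto
    obtain U V where U: "openin T U" "H \<inter> K = U \<inter> H" and V: "openin T V" "K \<inter> L = V \<inter> K"
      using o by (auto simp: openin_subtopology)
    have "H \<inter> K \<inter> L = (U \<inter> V) \<inter> H" using U(2) V(2) by blast
    then show "openin (subtopology T H) (H \<inter> K \<inter> L)"
      using U(1) V(1) by (auto simp: openin_subtopology)
    show "H \<inter> K \<inter> L \<subseteq> H \<inter> L" by blast
    show "\<one> \<in> H \<inter> K \<inter> L" using c clnD(1) subgroup.one_closed by auto
  qed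
  show "trans (loc_equiv G T)"
  proof (rule transI)
    fix H K L assume "(H, K) \<in> loc_equiv G T" "(K, L) \<in> loc_equiv G T"
    then have HKL: "H \<in> closed_locally_normal G T" "K \<in> closed_locally_normal G T"
      "L \<in> closed_locally_normal G T"
      "openin (subtopology T H) (H \<inter> K)" "openin (subtopology T K) (H \<inter> K)"
      "openin (subtopology T K) (K \<inter> L)" "openin (subtopology T L) (K \<inter> L)"
      by (auto simp: loc_equiv_def)
    have "openin (subtopology T H) (H \<inter> L)"
      using *[OF HKL(1,2,3,4,6)] .
    moreover have "openin (subtopology T L) (H \<inter> L)"
      using *[OF HKL(3,2,1)] HKL(5,7) by (simp only: Int_commute)
    ultimately show "(H, L) \<in> loc_equiv G T"
      using HKL(1,3) by (simp add: loc_equiv_def)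
  qed
qed

lemma conj_subset_eq_image: "conj_subset G g H = (\<lambda>x. g \<otimes> x \<otimes> inv g) ` H"
  by (auto simp: conj_subset_def l_coset_def r_coset_def)

lemma cancel_left:
  assumes "g \<in> carrier G" "x \<in> carrier G"
  shows "g \<otimes> (inv g \<otimes> x) = x" "inv g \<otimes> (g \<otimes> x) = x"
  using assms by (simp_all flip: m_assoc)

lemma homeomorphic_conj:
  assumes "g \<in> carrier G"
  shows "homeomorphic_map T T (\<lambda>x. g \<otimes> x \<otimes> inv g)"
proof (rule homeomorphic_maps_imp_map)
  have inv': "inv g \<otimes> (g \<otimes> x \<otimes> inv g) \<otimes> g = x" "g \<otimes> (inv g \<otimes> x \<otimes> g) \<otimes> inv g = x"
    if "x \<in> carrier G" for x
    using assms that by (simp_all add: m_assoc cancel_left)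
  show "homeomorphic_maps T T (\<lambda>x. g \<otimes> x \<otimes> inv g) (\<lambda>x. inv g \<otimes> x \<otimes> g)"
    using continuous_conj[OF assms] continuous_conj[of "inv g"] assms inv'
    by (auto simp: homeomorphic_maps_def topspace_eq)
qed

lemma mem_normalizer_iff:
  assumes "H \<subseteq> carrier G"
  shows "x \<in> normalizer G H \<longleftrightarrow> x \<in> carrier G \<and> conj_subset G x H = H"
  using assms by (simp add: normalizer_def stabilizer_def conj_subset_def)

lemma conj_subset_conj_subset:
  assumes "g \<in> carrier G" "h \<in> carrier G" "H \<subseteq> carrier G"
  shows "conj_subset G g (conj_subset G h H) = conj_subset G (g \<otimes> h) H"
  unfolding conj_subset_eq_image image_image
proof (rule image_cong)
  fix x assume "x \<in> H"
  then have "x \<in> carrier G" using assms(3) by blast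
  then show "g \<otimes> (h \<otimes> x \<otimes> inv h) \<otimes> inv g = g \<otimes> h \<otimes> x \<otimes> inv (g \<otimes> h)"
    using assms(1,2) by (simp add: m_assoc inv_mult_group)
qed simp

lemma conj_subset_closed:
  assumes "g \<in> carrier G" "H \<subseteq> carrier G"
  shows "conj_subset G g H \<subseteq> carrier G"
  using assms by (auto simp: conj_subset_eq_image)

lemma conj_subset_one: "H \<subseteq> carrier G \<Longrightarrow> conj_subset G \<one> H = H"
  by (force simp: conj_subset_eq_image)

lemma subgroup_conj_subset:
  assumes g: "g \<in> carrier G" and H: "subgroup H G"
  shows "subgroup (conj_subset G g H) G"
proof -
  have "(\<lambda>x. g \<otimes> x \<otimes> inv g) \<in> hom G G"
  proof (rule homI)
    fix x y assume xy: "x \<in> carrier G" "y \<in> carrier G"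
    have "g \<otimes> x \<otimes> inv g \<otimes> (g \<otimes> y \<otimes> inv g) = g \<otimes> x \<otimes> (inv g \<otimes> g) \<otimes> y \<otimes> inv g"
      using g xy by (simp only: m_assoc m_closed inv_closed)
    then show "g \<otimes> (x \<otimes> y) \<otimes> inv g = g \<otimes> x \<otimes> inv g \<otimes> (g \<otimes> y \<otimes> inv g)"
      using g xy by (simp add: m_assoc)
  qed (use g in auto)
  then interpret group_hom G G "\<lambda>x. g \<otimes> x \<otimes> inv g"
    by unfold_locales
  show ?thesis unfolding conj_subset_eq_image by (rule subgroup_img_is_subgroup[OF H])
qed

lemma normalizer_conj_subset:
  assumes g: "g \<in> carrier G" and H: "H \<subseteq> carrier G"
  shows "normalizer G (conj_subset G g H) = conj_subset G g (normalizer G H)"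
proof -
  have NG: "normalizer G K \<subseteq> carrier G" for K by (auto simp: normalizer_def stabilizer_def)
  have sub: "conj_subset G g (normalizer G H) \<subseteq> normalizer G (conj_subset G g H)"
    if g: "g \<in> carrier G" and H: "H \<subseteq> carrier G" for g H
  proof
    fix y assume "y \<in> conj_subset G g (normalizer G H)"
    then obtain x where x: "x \<in> normalizer G H" and y: "y = g \<otimes> x \<otimes> inv g"
      by (auto simp: conj_subset_eq_image)
    have xG: "x \<in> carrier G" and xH: "conj_subset G x H = H"
      using x by (auto simp: mem_normalizer_iff[OF H])
    have "y \<otimes> g = g \<otimes> x" using g xG by (simp add: y m_assoc)
    then have "conj_subset G y (conj_subset G g H) = conj_subset G g (conj_subset G x H)"
      using g xG H by (simp add: conj_subset_conj_subset y)
    then show "y \<in> normalizer G (conj_subset G g H)"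
      using xH g xG H by (simp add: mem_normalizer_iff conj_subset_closed y)
  qed
  have "normalizer G (conj_subset G g H)
      = conj_subset G g (conj_subset G (inv g) (normalizer G (conj_subset G g H)))"
    using g NG by (simp add: conj_subset_conj_subset conj_subset_one)
  also have "\<dots> \<subseteq> conj_subset G g (normalizer G (conj_subset G (inv g) (conj_subset G g H)))"
    using sub[of "inv g" "conj_subset G g H"] g H
    by (auto simp: conj_subset_eq_image[of g "normalizer _ _"]
        conj_subset_eq_image[of g "conj_subset _ _ _"] conj_subset_closed)
  also have "\<dots> = conj_subset G g (normalizer G H)"
    using g H by (simp add: conj_subset_conj_subset conj_subset_one)
  finally show ?thesis using sub[OF g H] by blast
qed

lemma conj_subset_closed_locally_normal:
  assumes g: "g \<in> carrier G" and H: "H \<in> closed_locally_normal G T"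
  shows "conj_subset G g H \<in> closed_locally_normal G T"
proof -
  note H' = clnD[OF H]
  have "closedin T (conj_subset G g H)"
    unfolding conj_subset_eq_image
    using homeomorphic_map_closedness[OF homeomorphic_conj[OF g]] H'(2,4) topspace_eq by simp
  moreover have "openin T (conj_subset G g (normalizer G H))"
    unfolding conj_subset_eq_image
    using homeomorphic_map_openness[OF homeomorphic_conj[OF g]] H'(3) openin_subset by metis
  ultimately show ?thesis
    using subgroup_conj_subset[OF g H'(1)] normalizer_conj_subset[OF g H'(4)]
    by (simp add: closed_locally_normal_def locally_normal_def)
qed

lemma conj_subset_loc_equiv:
  assumes g: "g \<in> carrier G" and HK: "(H, K) \<in> loc_equiv G T"
  shows "(conj_subset G g H, conj_subset G g K) \<in> loc_equiv G T"
proof -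
  let ?c = "\<lambda>x. g \<otimes> x \<otimes> inv g"
  have c: "H \<in> closed_locally_normal G T" "K \<in> closed_locally_normal G T"
    and o: "openin (subtopology T H) (H \<inter> K)" "openin (subtopology T K) (H \<inter> K)"
    using HK by (auto simp: loc_equiv_def)
  note hm = homeomorphic_conj[OF g]
  have inj: "inj_on ?c (carrier G)"
    using hm homeomorphic_imp_injective_map topspace_eq by metis
  have int: "?c ` (A \<inter> B) = ?c ` A \<inter> ?c ` B" if "A \<subseteq> carrier G" "B \<subseteq> carrier G" for A B
    using inj_on_image_Int[OF inj that] .
  have *: "openin (subtopology T (?c ` A)) (?c ` B)"
    if A: "A \<subseteq> carrier G" and op: "openin (subtopology T A) B" for A B
  proof -
    obtain U where U: "openin T U" "B = U \<inter> A" using op by (auto simp: openin_subtopology)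
    have UG: "U \<subseteq> carrier G" using openin_subset[OF U(1)] topspace_eq by simp
    have "openin T (?c ` U)"
      using homeomorphic_map_openness[OF hm] U(1) UG topspace_eq by simp
    then show ?thesis using int[OF UG A] U(2) by (auto simp: openin_subtopology)
  qed
  show ?thesis
    using *[OF clnD(4)[OF c(1)] o(1)] *[OF clnD(4)[OF c(2)] o(2)]
      int[OF clnD(4)[OF c(1)] clnD(4)[OF c(2)]]
      conj_subset_closed_locally_normal[OF g c(1)] conj_subset_closed_locally_normal[OF g c(2)]
    by (simp add: loc_equiv_def conj_subset_eq_image)
qed

lemma conj_class_eq:
  assumes g: "g \<in> carrier G" and H: "H \<in> closed_locally_normal G T"
  shows "conj_class G T g (loc_equiv G T `` {H}) = loc_equiv G T `` {conj_subset G g H}"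
proof -
  have "loc_equiv G T `` {conj_subset G g K} = loc_equiv G T `` {conj_subset G g H}"
    if "K \<in> loc_equiv G T `` {H}" for K
    using equiv_class_eq[OF equiv_loc_equiv] conj_subset_loc_equiv[OF g] that by blast
  moreover have "H \<in> loc_equiv G T `` {H}"
    by (rule equiv_class_self[OF equiv_loc_equiv H])
  ultimately show ?thesis unfolding conj_class_def by blast
qed

lemma closed_locally_normal_Int:
  assumes H: "H \<in> closed_locally_normal G T" and K: "K \<in> closed_locally_normal G T"
  shows "H \<inter> K \<in> closed_locally_normal G T"
proof -
  note h = clnD[OF H] and k = clnD[OF K]
  have HK: "H \<inter> K \<subseteq> carrier G" using h(4) by blast
  have sub: "subgroup (H \<inter> K) G" using h(1) k(1) by (rule subgroups_Inter_pair)
  have "normalizer G H \<inter> normalizer G K \<subseteq> normalizer G (H \<inter> K)"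
  proof
    fix x assume "x \<in> normalizer G H \<inter> normalizer G K"
    then have x: "x \<in> carrier G" "conj_subset G x H = H" "conj_subset G x K = K"
      using h(4) k(4) by (auto simp: mem_normalizer_iff)
    have "inj_on (\<lambda>y. x \<otimes> y \<otimes> inv x) (carrier G)"
      using homeomorphic_conj[OF x(1)] homeomorphic_imp_injective_map topspace_eq by metis
    then have "conj_subset G x (H \<inter> K) = H \<inter> K"
      using x(2,3) h(4) k(4) by (simp add: conj_subset_eq_image inj_on_image_Int)
    then show "x \<in> normalizer G (H \<inter> K)" using x(1) HK by (simp add: mem_normalizer_iff)
  qed
  moreover have "openin T (normalizer G H \<inter> normalizer G K)" using h(3) k(3) by blast
  moreover have "subgroup (normalizer G (H \<inter> K)) G"
    using HK by (rule normalizer_imp_subgroup)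
  moreover have "\<one> \<in> normalizer G H \<inter> normalizer G K"
    using h(4) k(4) by (simp add: mem_normalizer_iff conj_subset_one)
  moreover have "subtopology T (carrier G) = T" by (simp flip: topspace_eq)
  ultimately have "openin T (normalizer G (H \<inter> K))"
    using openin_subgroupI[OF subgroup_self, of "normalizer G (H \<inter> K)"]
    by (simp add: subgroup.subset)
  then show ?thesis using h(2) k(2) sub by (simp add: closed_locally_normal_def locally_normal_def
        closedin_Int)
qed

lemma partial_order_structure_lattice: "partial_order (structure_lattice G T)"
proof -
  let ?L = "structure_lattice G T" and ?C = "closed_locally_normal G T"
  have memC: "H \<in> ?C" if "\<alpha> \<in> carrier ?L" "H \<in> \<alpha>" for \<alpha> H
    using that by (auto simp: structure_lattice_def quotient_def loc_equiv_def)
  have rel: "(H, K) \<in> loc_equiv G T" if "\<alpha> \<in> carrier ?L" "H \<in> \<alpha>" "K \<in> \<alpha>" for \<alpha> H K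
    using quotient_eq_iff[OF equiv_loc_equiv, of \<alpha> \<alpha> H K] that
    by (simp add: structure_lattice_def)
  have mem: "K \<in> \<alpha>" if "\<alpha> \<in> carrier ?L" "H \<in> \<alpha>" "(H, K) \<in> loc_equiv G T" for \<alpha> H K
    using that in_quotient_imp_closed[OF equiv_loc_equiv] by (simp add: structure_lattice_def)
  have ne: "\<exists>H. H \<in> \<alpha>" if "\<alpha> \<in> carrier ?L" for \<alpha>
    using in_quotient_imp_non_empty[OF equiv_loc_equiv, of \<alpha>] that
    by (simp add: structure_lattice_def ex_in_conv)
  have eqI: "\<alpha> = \<beta>" if "\<alpha> \<in> carrier ?L" "\<beta> \<in> carrier ?L" "H \<in> \<alpha>" "K \<in> \<beta>" "(H, K) \<in> loc_equiv G T"
    for \<alpha> \<beta> H K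
    using quotient_eqI[OF equiv_loc_equiv] that by (simp add: structure_lattice_def)
  have op: "openin (subtopology T A) (A \<inter> B)"
    if "A \<in> ?C" "B \<in> ?C" "openin (subtopology T A) D" "D \<subseteq> A \<inter> B" "\<one> \<in> D" for A B D
    using openin_subgroupI[OF clnD(1)[OF that(1)]
        subgroups_Inter_pair[OF clnD(1)[OF that(1)] clnD(1)[OF that(2)]] Int_lower1 that(3-5)] .
  have one: "\<one> \<in> A" if "A \<in> ?C" for A using subgroup.one_closed[OF clnD(1)[OF that]] .
  have le: "\<alpha> \<sqsubseteq>\<^bsub>?L\<^esub> \<beta> \<longleftrightarrow> (\<exists>H\<in>\<alpha>. \<exists>K\<in>\<beta>. H \<subseteq> K)" for \<alpha> \<beta> by (simp add: structure_lattice_def)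
  have eq: "\<alpha> .=\<^bsub>?L\<^esub> \<beta> \<longleftrightarrow> \<alpha> = \<beta>" for \<alpha> \<beta> by (simp add: structure_lattice_def)
  have anti: "\<alpha> = \<beta>" if c: "\<alpha> \<in> carrier ?L" "\<beta> \<in> carrier ?L" and l: "\<alpha> \<sqsubseteq>\<^bsub>?L\<^esub> \<beta>" "\<beta> \<sqsubseteq>\<^bsub>?L\<^esub> \<alpha>" for \<alpha> \<beta>
  proof -
    obtain H K K' H' where m: "H \<in> \<alpha>" "K \<in> \<beta>" "H \<subseteq> K" "K' \<in> \<beta>" "H' \<in> \<alpha>" "K' \<subseteq> H'"
      using l unfolding le by blast
    have C: "H \<in> ?C" "K \<in> ?C" "H' \<in> ?C" "K' \<in> ?C" using m memC c by auto
    have "openin (subtopology T K) (K \<inter> K')" "openin (subtopology T H') (H \<inter> H')"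
      using rel[OF c(2) m(2,4)] rel[OF c(1) m(1,5)] by (auto simp: loc_equiv_def)
    then obtain U V where U: "openin T U" "K \<inter> K' = U \<inter> K" and V: "openin T V" "H \<inter> H' = V \<inter> H'"
      by (auto simp: openin_subtopology)
    have "openin (subtopology T K) (U \<inter> V \<inter> K)" using U(1) V(1) by (auto simp: openin_subtopology)
    moreover have "U \<inter> V \<inter> K \<subseteq> K \<inter> H" using U(2) V(2) m by blast
    moreover have "\<one> \<in> U \<inter> V \<inter> K" using U(2) V(2) one C by blast
    ultimately have "openin (subtopology T K) (K \<inter> H)" by (rule op[OF C(2,1)])
    then have "(H, K) \<in> loc_equiv G T"
      using C m(3) clnD(4)[OF C(1)]
      by (simp add: loc_equiv_def Int_absorb1 Int_absorb2 openin_subtopology_refl topspace_eq)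
    then show ?thesis using eqI c m by blast
  qed
  have tr: "\<alpha> \<sqsubseteq>\<^bsub>?L\<^esub> \<gamma>" if c: "\<alpha> \<in> carrier ?L" "\<beta> \<in> carrier ?L" "\<gamma> \<in> carrier ?L"
    and l: "\<alpha> \<sqsubseteq>\<^bsub>?L\<^esub> \<beta>" "\<beta> \<sqsubseteq>\<^bsub>?L\<^esub> \<gamma>" for \<alpha> \<beta> \<gamma>
  proof -
    obtain H K K' M where m: "H \<in> \<alpha>" "K \<in> \<beta>" "H \<subseteq> K" "K' \<in> \<beta>" "M \<in> \<gamma>" "K' \<subseteq> M"
      using l unfolding le by blast
    have C: "H \<in> ?C" "K \<in> ?C" "K' \<in> ?C" using m memC c by auto
    have I: "H \<inter> K' \<in> ?C" using C closed_locally_normal_Int by blast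
    have "openin (subtopology T K) (K \<inter> K')"
      using rel[OF c(2) m(2,4)] by (auto simp: loc_equiv_def)
    then obtain U where U: "openin T U" "K \<inter> K' = U \<inter> K" by (auto simp: openin_subtopology)
    then have "H \<inter> K' = U \<inter> H" using m by blast
    then have "openin (subtopology T H) (H \<inter> K')" using U(1) by (auto simp: openin_subtopology)
    then have "(H, H \<inter> K') \<in> loc_equiv G T"
      using C I clnD(4)[OF I]
      by (simp add: loc_equiv_def openin_subtopology_refl topspace_eq Int_left_absorb)
    then have "H \<inter> K' \<in> \<alpha>" by (rule mem[OF c(1) m(1)])
    moreover have "H \<inter> K' \<subseteq> M" using m by blast
    ultimately show ?thesis unfolding le using m(5) by blast
  qed
  have refl: "\<alpha> \<sqsubseteq>\<^bsub>?L\<^esub> \<alpha>" if "\<alpha> \<in> carrier ?L" for \<alpha>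
    unfolding le using ne[OF that] by blast
  show ?thesis
  proof (rule partial_order.intro)
    show "weak_partial_order ?L"
    proof unfold_locales
      fix x y z assume "x \<in> carrier ?L" "y \<in> carrier ?L" "z \<in> carrier ?L" "x \<sqsubseteq>\<^bsub>?L\<^esub> y" "y \<sqsubseteq>\<^bsub>?L\<^esub> z"
      then show "x \<sqsubseteq>\<^bsub>?L\<^esub> z" using tr by blast
    qed (use anti in \<open>simp_all add: refl eq\<close>)
    show "partial_order_axioms ?L"
      by unfold_locales (simp add: structure_lattice_def)
  qed
qed

end

end

theory Submission
  imports Defs
begin

text \<open>Represent \<open>\<alpha>\<close> by \<open>H \<noteq> {\<one>}\<close> and fix a compact open subgroup \<open>U\<close>. The normal closure \<open>D\<close> of
  \<open>H\<close> is dense, so \<open>G = D U\<close>, and by compact generation finitely many conjugates of \<open>H\<close>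
  generate \<open>G\<close> together with \<open>U\<close>. Orbits of \<open>U\<close> on the structure lattice are finite, so the classes
  of these conjugates lie in a finite \<open>U\<close>-invariant set, whose join \<open>\<beta>\<close> is then fixed by \<open>U\<close>.
  It is also fixed by each of the conjugates \<open>K\<close> that were chosen: for \<open>k \<in> K\<close> and \<open>x\<close> in a second
  such conjugate \<open>L\<close>, close enough to \<open>\<one>\<close> to normalise \<open>K\<close>, the element
  \<open>k x k\<inverse> = x (x\<inverse> k x k\<inverse>)\<close> lies in \<open>L K\<close>, whence \<open>k[L] \<le> [L] \<or> [K] \<le> \<beta>\<close>. So \<open>G\<close> fixes \<open>\<beta>\<close>.\<close>

context topological_group
begin

section \<open>Open subgroups and their cosets\<close>

lemma openin_preimage:
  assumes "continuous_map T T f" "openin T W"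
  shows "openin T {x \<in> carrier G. f x \<in> W}"
  using openin_continuous_map_preimage[OF assms] by (simp add: topspace_eq)

lemma continuous_map_mult:
  assumes "continuous_map S T f" "continuous_map S T g"
  shows "continuous_map S T (\<lambda>x. f x \<otimes> g x)"
  using continuous_map_compose[OF continuous_map_pairedI[OF assms] continuous_mult]
  by (simp add: o_def)

lemma continuous_map_inv:
  "continuous_map S T f \<Longrightarrow> continuous_map S T (\<lambda>x. inv f x)"
  using continuous_map_compose[OF _ continuous_inv] by (simp add: o_def)

lemma openin_subgroup_nhd:
  assumes "subgroup A G" "openin T B" "B \<subseteq> A" "\<one> \<in> B"
  shows "openin T A"
  using openin_subgroupI[OF subgroup_self assms(1) subgroup.subset[OF assms(1)] _ assms(3,4)] assms(2)
  by (simp flip: topspace_eq)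

lemma l_coset_eq_preimage:
  assumes "d \<in> carrier G" "N \<subseteq> carrier G"
  shows "d <#\<^bsub>G\<^esub> N = {x \<in> carrier G. inv d \<otimes> x \<in> N}"
  using assms by (force simp: l_coset_def cancel_left)

lemma openin_l_coset:
  assumes "d \<in> carrier G" "openin T N"
  shows "openin T (d <#\<^bsub>G\<^esub> N)"
  using openin_preimage[OF continuous_translation(1)[of "inv d"] assms(2)] assms(1)
    l_coset_eq_preimage[OF assms(1)] openin_subset[OF assms(2)] topspace_eq by simp

text \<open>The complement is a union of left cosets, each of them open as a translate of
  \<open>N\<close>.\<close>

lemma closedin_open_subgroup:
  assumes N: "subgroup N G" "openin T N"
  shows "closedin T N"
proof -
  have "carrier G - N = (\<Union>d\<in>carrier G - N. d <#\<^bsub>G\<^esub> N)"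
  proof -
    have "(d <#\<^bsub>G\<^esub> N) \<inter> N = {}" if "d \<in> carrier G - N" for d
    proof -
      have "d \<in> N" if "n \<in> N" "d \<otimes> n \<in> N" for n
      proof -
        have "d \<otimes> n \<otimes> inv n \<in> N"
          using that N(1) by (simp add: subgroup.m_closed subgroup.m_inv_closed)
        then show ?thesis
          using that \<open>d \<in> _\<close> subgroup.mem_carrier[OF N(1)] by (simp add: m_assoc)
      qed
      then show ?thesis using \<open>d \<in> _\<close> by (auto simp: l_coset_def)
    qed
    moreover have "d \<in> d <#\<^bsub>G\<^esub> N" if "d \<in> carrier G" for d
      using that subgroup.one_closed[OF N(1)] by (force simp: l_coset_def)
    moreover have "d <#\<^bsub>G\<^esub> N \<subseteq> carrier G" if "d \<in> carrier G" for d
      using that subgroup.subset[OF N(1)] by (rule l_coset_subset_G[rotated])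
    ultimately show ?thesis by blast
  qed
  moreover have "openin T (\<Union>d\<in>carrier G - N. d <#\<^bsub>G\<^esub> N)"
    using openin_l_coset N(2) by blast
  ultimately show ?thesis
    using subgroup.subset[OF N(1)] by (simp add: closedin_def topspace_eq)
qed

text \<open>Serves twice: with \<open>N\<close> a normaliser it bounds orbits of classes, with
  \<open>N\<close> a compact open subgroup it selects finitely many elements of the normal
  closure.\<close>

lemma compactin_finite_l_cosets:
  assumes "compactin T C" "openin T N" "D \<subseteq> carrier G" "C \<subseteq> (\<Union>d\<in>D. d <#\<^bsub>G\<^esub> N)"
  obtains F where "finite F" "F \<subseteq> D" "C \<subseteq> (\<Union>d\<in>F. d <#\<^bsub>G\<^esub> N)"
proof -
  have "\<exists>\<F>. finite \<F> \<and> \<F> \<subseteq> (\<lambda>d. d <#\<^bsub>G\<^esub> N) ` D \<and> C \<subseteq> \<Union>\<F>"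
    using assms openin_l_coset by (intro compactinD[OF assms(1)]) auto
  then show thesis using that by (metis finite_subset_image)
qed

section \<open>Classes and the order of the structure lattice\<close>

abbreviation (input) cln where "cln \<equiv> closed_locally_normal G T"
abbreviation (input) cls where "cls H \<equiv> loc_equiv G T `` {H}"
abbreviation (input) LN where "LN \<equiv> structure_lattice G T"

lemma mem_carrier_LN: "\<alpha> \<in> carrier LN \<longleftrightarrow> (\<exists>H\<in>cln. \<alpha> = cls H)"
  by (auto simp: structure_lattice_def quotient_def)

lemma cls_carrier: "H \<in> cln \<Longrightarrow> cls H \<in> carrier LN"
  by (auto simp: mem_carrier_LN)

lemma cls_self: "H \<in> cln \<Longrightarrow> H \<in> cls H"
  by (rule equiv_class_self[OF equiv_loc_equiv])

lemma cls_eq: "H \<in> cls K \<Longrightarrow> cls H = cls K"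
  using equiv_class_eq[OF equiv_loc_equiv] by blast

lemma le_LN_I: "H \<in> \<alpha> \<Longrightarrow> K \<in> \<beta> \<Longrightarrow> H \<subseteq> K \<Longrightarrow> \<alpha> \<sqsubseteq>\<^bsub>LN\<^esub> \<beta>"
  by (auto simp: structure_lattice_def)

text \<open>Turns the order into a condition near \<open>\<one>\<close> on fixed representatives.
  Conversely, if \<open>A \<inter> W \<subseteq> B\<close>, then \<open>A \<inter> B\<close> is open
  in \<open>A\<close>, so it represents the class of \<open>A\<close> and lies in
  \<open>B\<close>.\<close>

lemma le_cls_iff:
  assumes A: "A \<in> cln" and B: "B \<in> cln"
  shows "cls A \<sqsubseteq>\<^bsub>LN\<^esub> cls B \<longleftrightarrow> (\<exists>W. openin T W \<and> \<one> \<in> W \<and> A \<inter> W \<subseteq> B)"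
proof
  assume "cls A \<sqsubseteq>\<^bsub>LN\<^esub> cls B"
  then obtain A' B' where AB: "(A, A') \<in> loc_equiv G T" "(B, B') \<in> loc_equiv G T" "A' \<subseteq> B'"
    by (auto simp: structure_lattice_def)
  then obtain U V where U: "openin T U" "A \<inter> A' = U \<inter> A" and V: "openin T V" "B \<inter> B' = V \<inter> B'"
    by (auto simp: loc_equiv_def openin_subtopology)
  have "A' \<in> cln" "B' \<in> cln" using AB by (auto simp: loc_equiv_def)
  then have "\<one> \<in> A \<inter> A'" "\<one> \<in> B \<inter> B'"
    using A B clnD(1) subgroup.one_closed by blast+
  then have "\<one> \<in> U \<inter> V" using U V by blast
  moreover have "A \<inter> (U \<inter> V) \<subseteq> B" using U V AB(3) by blast
  ultimately show "\<exists>W. openin T W \<and> \<one> \<in> W \<and> A \<inter> W \<subseteq> B" using U(1) V(1) by blast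
next
  assume "\<exists>W. openin T W \<and> \<one> \<in> W \<and> A \<inter> W \<subseteq> B"
  then obtain W where W: "openin T W" "\<one> \<in> W" "A \<inter> W \<subseteq> B" by blast
  note AB = closed_locally_normal_Int[OF A B]
  have "openin (subtopology T A) (A \<inter> B)"
  proof (rule openin_subgroupI)
    show "openin (subtopology T A) (W \<inter> A)" using W(1) by (auto simp: openin_subtopology)
    show "\<one> \<in> W \<inter> A" using W(2) clnD(1)[OF A] subgroup.one_closed by blast
  qed (use W(3) clnD[OF A] clnD[OF AB] in auto)
  then have "A \<inter> B \<in> cls A"
    using A AB clnD(4)[OF AB]
    by (simp add: loc_equiv_def openin_subtopology_refl topspace_eq Int_left_absorb)
  then show "cls A \<sqsubseteq>\<^bsub>LN\<^esub> cls B" using cls_self[OF B] by (rule le_LN_I) blast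
qed

section \<open>The conjugation action on classes\<close>

lemma conj_class_carrier:
  assumes "g \<in> carrier G" "\<alpha> \<in> carrier LN"
  shows "conj_class G T g \<alpha> \<in> carrier LN"
  using assms conj_class_eq conj_subset_closed_locally_normal by (auto simp: mem_carrier_LN)

lemma conj_class_one:
  assumes "\<alpha> \<in> carrier LN"
  shows "conj_class G T \<one> \<alpha> = \<alpha>"
  using assms conj_class_eq conj_subset_one clnD(4) by (auto simp: mem_carrier_LN)

lemma conj_class_mult:
  assumes "g \<in> carrier G" "h \<in> carrier G" "\<alpha> \<in> carrier LN"
  shows "conj_class G T (g \<otimes> h) \<alpha> = conj_class G T g (conj_class G T h \<alpha>)"
  using assms conj_class_eq conj_subset_closed_locally_normal conj_subset_conj_subset clnD(4)
  by (auto simp: mem_carrier_LN)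

lemma conj_class_mono:
  assumes "g \<in> carrier G" "\<alpha> \<in> carrier LN" "\<beta> \<in> carrier LN" "\<alpha> \<sqsubseteq>\<^bsub>LN\<^esub> \<beta>"
  shows "conj_class G T g \<alpha> \<sqsubseteq>\<^bsub>LN\<^esub> conj_class G T g \<beta>"
proof -
  have *: "conj_subset G g H \<in> conj_class G T g \<alpha>" if "\<alpha> \<in> carrier LN" "H \<in> \<alpha>" for \<alpha> H
  proof -
    have "H \<in> cln" using that by (auto simp: mem_carrier_LN loc_equiv_def)
    then show ?thesis
      using cls_self[OF conj_subset_closed_locally_normal[OF assms(1)]] that
      unfolding conj_class_def by blast
  qed
  obtain H K where "H \<in> \<alpha>" "K \<in> \<beta>" "H \<subseteq> K" using assms(4) by (auto simp: structure_lattice_def)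
  then show ?thesis
    using le_LN_I[OF *[OF assms(2)] *[OF assms(3)]] by (simp add: conj_subset_eq_image image_mono)
qed

text \<open>Reduces invariance under \<open>G\<close> to invariance under a generating set.\<close>

lemma subgroup_stabilizer_class:
  assumes "\<alpha> \<in> carrier LN"
  shows "subgroup {g \<in> carrier G. conj_class G T g \<alpha> = \<alpha>} G"
proof (rule subgroupI)
  fix g assume "g \<in> {g \<in> carrier G. conj_class G T g \<alpha> = \<alpha>}"
  then have g: "g \<in> carrier G" "conj_class G T g \<alpha> = \<alpha>" by auto
  have "conj_class G T (inv g) (conj_class G T g \<alpha>) = \<alpha>"
    using conj_class_mult[of "inv g" g] conj_class_one assms g(1) by simp
  then show "inv g \<in> {g \<in> carrier G. conj_class G T g \<alpha> = \<alpha>}" using g by simp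
qed (use assms conj_class_one conj_class_mult in auto)

text \<open>The normaliser is open by local normality, so every class is fixed by an open
  subgroup.\<close>

lemma conj_class_normalizer:
  assumes H: "H \<in> cln" and n: "n \<in> normalizer G H"
  shows "conj_class G T n (cls H) = cls H"
  using n conj_class_eq[of n H] H mem_normalizer_iff clnD(4)[OF H] by simp

lemma subgroup_subset_normalizer:
  assumes "subgroup H G"
  shows "H \<subseteq> normalizer G H"
proof
  fix x assume x: "x \<in> H"
  have "conj_subset G y H \<subseteq> H" if "y \<in> H" for y
    using that assms
    by (auto simp: conj_subset_eq_image subgroup.m_closed subgroup.m_inv_closed)
  moreover have xG: "x \<in> carrier G" using x subgroup.subset[OF assms] by blast
  \<comment> \<open>Conjugating the inclusion for \<open>inv x\<close> by \<open>x\<close> yields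
    the reverse inclusion for \<open>x\<close>.\<close>
  moreover have "conj_subset G x (conj_subset G (inv x) H) = H"
    using xG subgroup.subset[OF assms] by (simp add: conj_subset_conj_subset conj_subset_one)
  ultimately have "conj_subset G x H = H"
    using x assms subgroup.m_inv_closed[OF assms x]
    by (metis conj_subset_eq_image image_mono subset_antisym)
  then show "x \<in> normalizer G H"
    using xG subgroup.subset[OF assms] by (simp add: mem_normalizer_iff)
qed

lemma open_subgroup_cln:
  assumes "subgroup V G" "openin T V"
  shows "V \<in> cln"
  using assms closedin_open_subgroup subgroup_subset_normalizer[OF assms(1)]
    openin_subgroup_nhd[OF normalizer_imp_subgroup[OF subgroup.subset[OF assms(1)]]]
    subgroup.one_closed[OF assms(1)]
  by (simp add: closed_locally_normal_def locally_normal_def)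

text \<open>Allows a representative to be shrunk into a compact open subgroup, where the product
  construction for joins applies.\<close>

lemma cls_Int_open_subgroup:
  assumes H: "H \<in> cln" and V: "subgroup V G" "openin T V"
  shows "H \<inter> V \<in> cln" "cls (H \<inter> V) = cls H"
proof -
  show c: "H \<inter> V \<in> cln" using closed_locally_normal_Int[OF H open_subgroup_cln[OF V]] .
  have "openin (subtopology T H) (H \<inter> V)"
    using V(2) by (auto simp: openin_subtopology)
  then have "H \<inter> V \<in> cls H"
    using H c clnD(4)[OF c] by (simp add: loc_equiv_def openin_subtopology_refl topspace_eq Int_left_absorb)
  then show "cls (H \<inter> V) = cls H" by (rule cls_eq)
qed

text \<open>No join is formed here: for \<open>x\<close> in \<open>K\<close> near
  \<open>\<one>\<close> and \<open>y = k \<otimes> x \<otimes> inv k\<close>, the factors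
  \<open>x\<close> and \<open>inv x \<otimes> y\<close> lie in \<open>K\<close> and \<open>H\<close>
  respectively, and near \<open>\<one>\<close> both fall into the arbitrary upper bound
  \<open>B\<close>.\<close>

lemma conj_class_le_upper_bound:
  assumes H: "H \<in> cln" and K: "K \<in> cln" and B: "B \<in> cln"
    and HB: "cls H \<sqsubseteq>\<^bsub>LN\<^esub> cls B" and KB: "cls K \<sqsubseteq>\<^bsub>LN\<^esub> cls B" and k: "k \<in> H"
  shows "conj_class G T k (cls K) \<sqsubseteq>\<^bsub>LN\<^esub> cls B"
proof -
  obtain W where W: "openin T W" "\<one> \<in> W" "H \<inter> W \<subseteq> B" using HB le_cls_iff[OF H B] by blast
  obtain W' where W': "openin T W'" "\<one> \<in> W'" "K \<inter> W' \<subseteq> B" using KB le_cls_iff[OF K B] by blast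
  note h = clnD[OF H]
  have kG: "k \<in> carrier G" using k h(4) by blast
  \<comment> \<open>\<open>?x y\<close> recovers \<open>x\<close> from its conjugate
    \<open>y\<close>. Membership of \<open>y\<close> in \<open>Z\<close> says that \<open>x\<close>
    is near enough to \<open>\<one>\<close> to lie in \<open>B\<close> and to normalise
    \<open>H\<close>, and that the commutator \<open>inv x \<otimes> y\<close> is near enough to lie
    in \<open>B\<close>.\<close>
  let ?x = "\<lambda>y. inv k \<otimes> y \<otimes> inv (inv k)"
  define Z where "Z = {y \<in> carrier G. ?x y \<in> W' \<inter> normalizer G H} \<inter>
    {y \<in> carrier G. inv (?x y) \<otimes> y \<in> W}"
  have cx: "continuous_map T T ?x" using kG by (intro continuous_conj) simp
  have "continuous_map T T (\<lambda>y. inv (?x y) \<otimes> y)"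
    by (intro continuous_map_mult continuous_map_inv cx) simp
  then have "openin T Z" unfolding Z_def
    using W(1) W'(1) h(3) cx by (intro openin_Int openin_preimage) auto
  moreover have "\<one> \<in> Z"
    using kG W(2) W'(2) subgroup.one_closed[OF normalizer_imp_subgroup[OF h(4)]] by (simp add: Z_def)
  moreover have "conj_subset G k K \<inter> Z \<subseteq> B"
  proof
    fix y assume y: "y \<in> conj_subset G k K \<inter> Z"
    then obtain x where x: "x \<in> K" "y = k \<otimes> x \<otimes> inv k" by (auto simp: conj_subset_eq_image)
    have xG: "x \<in> carrier G" using x(1) clnD(4)[OF K] by blast
    have xy: "?x y = x" using x(2) xG kG by (simp add: m_assoc cancel_left)
    have x': "x \<in> W'" "x \<in> normalizer G H" "inv x \<otimes> y \<in> W" using y xy by (auto simp: Z_def)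
    have "inv x \<in> normalizer G H"
      using x'(2) subgroup.m_inv_closed[OF normalizer_imp_subgroup[OF h(4)]] by blast
    then have "inv x \<otimes> k \<otimes> inv (inv x) \<in> H"
      using k mem_normalizer_iff[OF h(4)] unfolding conj_subset_eq_image by blast
    then have "inv x \<otimes> k \<otimes> x \<otimes> inv k \<in> H"
      using k h(1) xG by (simp add: subgroup.m_closed subgroup.m_inv_closed)
    then have "inv x \<otimes> y \<in> B" using x'(3) W(3) x(2) xG kG by (auto simp: m_assoc)
    moreover have "x \<in> B" using x(1) x'(1) W'(3) by blast
    ultimately have "x \<otimes> (inv x \<otimes> y) \<in> B"
      using subgroup.m_closed[OF clnD(1)[OF B]] by blast
    then show "y \<in> B" using xG x(2) kG by (simp add: cancel_left)
  qed
  ultimately show ?thesis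
    using le_cls_iff[OF conj_subset_closed_locally_normal[OF kG K] B] conj_class_eq[OF kG K] by auto
qed

section \<open>Products of locally normal subgroups as joins\<close>

lemma normalizer_Int:
  assumes "H \<subseteq> carrier G" "K \<subseteq> carrier G"
  shows "normalizer G H \<inter> normalizer G K \<subseteq> normalizer G (H \<inter> K)"
proof
  fix x assume "x \<in> normalizer G H \<inter> normalizer G K"
  then have x: "x \<in> carrier G" "conj_subset G x H = H" "conj_subset G x K = K"
    using assms by (auto simp: mem_normalizer_iff)
  have "inj_on (\<lambda>y. x \<otimes> y \<otimes> inv x) (carrier G)"
    using homeomorphic_conj[OF x(1)] homeomorphic_imp_injective_map topspace_eq by metis
  then have "conj_subset G x (H \<inter> K) = H \<inter> K"
    using x(2,3) assms by (simp add: conj_subset_eq_image inj_on_image_Int)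
  then show "x \<in> normalizer G (H \<inter> K)" using x(1) assms(1) by (simp add: mem_normalizer_iff le_infI1)
qed

lemma conj_subset_set_mult:
  assumes g: "g \<in> carrier G" and A: "A \<subseteq> carrier G" and B: "B \<subseteq> carrier G"
  shows "conj_subset G g (A <#> B) = conj_subset G g A <#> conj_subset G g B"
proof -
  have "g \<otimes> (a \<otimes> b) \<otimes> inv g = (g \<otimes> a \<otimes> inv g) \<otimes> (g \<otimes> b \<otimes> inv g)" if "a \<in> A" "b \<in> B" for a b
  proof -
    have "a \<in> carrier G" "b \<in> carrier G" using that A B by auto
    then show ?thesis using g by (simp add: m_assoc cancel_left)
  qed
  then show ?thesis by (simp add: conj_subset_eq_image set_mult_def image_UN)
qed

lemma subgroup_set_mult:
  assumes A: "subgroup A G" and B: "subgroup B G" and BA: "B \<subseteq> normalizer G A"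
  shows "subgroup (A <#> B) G"
proof -
  have AG: "A \<subseteq> carrier G" and BG: "B \<subseteq> carrier G" using A B subgroup.subset by auto
  have conj: "b \<otimes> a \<otimes> inv b \<in> A" if "a \<in> A" "b \<in> B" for a b
    using that BA mem_normalizer_iff[OF AG] unfolding conj_subset_eq_image by blast
  have I: "a \<otimes> b \<in> A <#> B" if "a \<in> A" "b \<in> B" for a b
    using that by (auto simp: set_mult_def)
  show ?thesis
  proof (rule subgroupI)
    show "A <#> B \<subseteq> carrier G" using AG BG by (rule set_mult_closed)
    show "A <#> B \<noteq> {}" using I A B subgroup.one_closed by blast
    fix x assume "x \<in> A <#> B"
    then obtain a b where x: "a \<in> A" "b \<in> B" "x = a \<otimes> b" by (auto simp: set_mult_def)
    have c: "a \<in> carrier G" "b \<in> carrier G" using x AG BG by auto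
    \<comment> \<open>Conjugation by elements of \<open>B\<close> preserves \<open>A\<close>, so
      factors from \<open>A\<close> can be moved to the left.\<close>
    have "inv x = (inv b \<otimes> inv a \<otimes> inv (inv b)) \<otimes> inv b"
      using c x(3) by (simp add: m_assoc inv_mult_group)
    then show "inv x \<in> A <#> B"
      using I[OF conj] x(1,2) subgroup.m_inv_closed[OF A] subgroup.m_inv_closed[OF B] by simp
    fix y assume "y \<in> A <#> B"
    then obtain a' b' where y: "a' \<in> A" "b' \<in> B" "y = a' \<otimes> b'" by (auto simp: set_mult_def)
    have c': "a' \<in> carrier G" "b' \<in> carrier G" using y AG BG by auto
    have "x \<otimes> y = (a \<otimes> (b \<otimes> a' \<otimes> inv b)) \<otimes> (b \<otimes> b')"
      using c c' x(3) y(3) by (simp add: m_assoc cancel_left)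
    then show "x \<otimes> y \<in> A <#> B"
      using I[OF subgroup.m_closed[OF A] subgroup.m_closed[OF B]] conj x(1,2) y(1,2) by simp
  qed
qed

lemma compactin_mult_image:
  "compactin (prod_topology T T) Q \<Longrightarrow> compactin T ((\<lambda>(x, y). x \<otimes> y) ` Q)"
  using image_compactin continuous_mult by blast

text \<open>The product is closed as a continuous image of a compact set in a Hausdorff space. Its
  normaliser is open because it contains everything that normalises both factors.\<close>

lemma set_mult_cln:
  assumes A: "A \<in> cln" "compactin T A" and B: "B \<in> cln" "compactin T B"
    and BA: "B \<subseteq> normalizer G A" and T: "Hausdorff_space T"
  shows "A <#> B \<in> cln"
proof -
  note a = clnD[OF A(1)] and b = clnD[OF B(1)]
  have sub: "subgroup (A <#> B) G" using subgroup_set_mult a(1) b(1) BA by blast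
  have "A <#> B = (\<lambda>(x, y). x \<otimes> y) ` (A \<times> B)" by (auto simp: set_mult_def)
  then have "closedin T (A <#> B)"
    using compactin_imp_closedin[OF T compactin_mult_image] A(2) B(2)
    by (simp add: compactin_Times)
  moreover have "openin T (normalizer G (A <#> B))"
  proof (rule openin_subgroup_nhd)
    show "subgroup (normalizer G (A <#> B)) G"
      using sub normalizer_imp_subgroup subgroup.subset by blast
    show "openin T (normalizer G A \<inter> normalizer G B)" using a(3) b(3) by blast
    show "normalizer G A \<inter> normalizer G B \<subseteq> normalizer G (A <#> B)"
      using a(4) b(4) subgroup.subset[OF sub] by (auto simp: mem_normalizer_iff conj_subset_set_mult)
    show "\<one> \<in> normalizer G A \<inter> normalizer G B"
      using a(4) b(4) by (simp add: mem_normalizer_iff conj_subset_one)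
  qed
  ultimately show ?thesis using sub by (simp add: closed_locally_normal_def locally_normal_def)
qed

text \<open>The join property holds because a product \<open>a \<otimes> b\<close> close to \<open>\<one>\<close> can be
  rewritten as \<open>(a \<otimes> c) \<otimes> (inv c \<otimes> b)\<close> with \<open>c \<in> A \<inter> B\<close> and both factors close to \<open>\<one>\<close>: the
  pairs \<open>(a, b)\<close> that do not admit such a \<open>c\<close> form a compact set, and \<open>\<one>\<close> is not among their
  products.\<close>

lemma least_set_mult:
  assumes A: "A \<in> cln" "compactin T A" and B: "B \<in> cln" "compactin T B"
    and BA: "B \<subseteq> normalizer G A" and T: "Hausdorff_space T"
  shows "least LN (cls (A <#> B)) (Upper LN {cls A, cls B})"
proof (rule least_UpperI)
  note a = clnD[OF A(1)] and b = clnD[OF B(1)]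
  note AB = set_mult_cln[OF assms]
  have one: "\<one> \<in> A" "\<one> \<in> B" using a(1) b(1) subgroup.one_closed by auto
  have "A \<subseteq> A <#> B"
  proof
    fix x assume "x \<in> A"
    then have "x = x \<otimes> \<one>" using a(4) by auto
    then show "x \<in> A <#> B" using \<open>x \<in> A\<close> one by (auto simp: set_mult_def)
  qed
  moreover have "B \<subseteq> A <#> B"
  proof
    fix x assume "x \<in> B"
    then have "x = \<one> \<otimes> x" using b(4) by auto
    then show "x \<in> A <#> B" using \<open>x \<in> B\<close> one by (auto simp: set_mult_def)
  qed
  ultimately show "x \<sqsubseteq>\<^bsub>LN\<^esub> cls (A <#> B)" if "x \<in> {cls A, cls B}" for x
    using that le_LN_I[OF cls_self cls_self] A(1) B(1) AB by blast
  show "{cls A, cls B} \<subseteq> carrier LN" "cls (A <#> B) \<in> carrier LN"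
    using A(1) B(1) AB cls_carrier by auto
  fix \<gamma> assume \<gamma>: "\<gamma> \<in> Upper LN {cls A, cls B}"
  then have "\<gamma> \<in> carrier LN" by (simp add: Upper_def)
  then obtain C where C: "C \<in> cln" and \<gamma>C: "\<gamma> = cls C" by (auto simp: mem_carrier_LN)
  have "cls A \<sqsubseteq>\<^bsub>LN\<^esub> cls C" "cls B \<sqsubseteq>\<^bsub>LN\<^esub> cls C"
    using \<gamma> A(1) B(1) cls_carrier by (auto simp: Upper_def \<gamma>C)
  then obtain W1 W2 where W12: "openin T W1" "\<one> \<in> W1" "A \<inter> W1 \<subseteq> C"
      "openin T W2" "\<one> \<in> W2" "B \<inter> W2 \<subseteq> C"
    using le_cls_iff A(1) B(1) C by metis
  define W where "W = W1 \<inter> W2"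
  have W: "openin T W" "\<one> \<in> W" "A \<inter> W \<subseteq> C" "B \<inter> W \<subseteq> C"
    using W12 by (auto simp: W_def)
  let ?T2 = "prod_topology T T"
  define P where "P = (\<Union>c\<in>A \<inter> B. {p \<in> topspace ?T2. fst p \<otimes> c \<in> W} \<inter> {p \<in> topspace ?T2. inv c \<otimes> snd p \<in> W})"
  have "openin ?T2 P"
  proof -
    have "openin ?T2 {p \<in> topspace ?T2. fst p \<otimes> c \<in> W}"
      "openin ?T2 {p \<in> topspace ?T2. inv c \<otimes> snd p \<in> W}" if "c \<in> A \<inter> B" for c
      using that a(4)
      by (intro openin_continuous_map_preimage[OF _ W(1)] continuous_map_mult
          continuous_map_fst continuous_map_snd; force simp: topspace_eq)+
    then show ?thesis unfolding P_def by blast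
  qed
  then have "closedin ?T2 (topspace ?T2 - P)" by blast
  then have "compactin ?T2 ((topspace ?T2 - P) \<inter> (A \<times> B))"
    using A(2) B(2) by (intro closed_Int_compactin) (simp_all add: compactin_Times)
  then have cl: "closedin T ((\<lambda>(x, y). x \<otimes> y) ` ((topspace ?T2 - P) \<inter> (A \<times> B)))" (is "closedin T ?Z")
    by (intro compactin_imp_closedin[OF T] compactin_mult_image)
  have "openin T (carrier G - ?Z)" using cl by (simp add: closedin_def topspace_eq)
  \<comment> \<open>If \<open>x \<otimes> y = \<one>\<close>, then \<open>y = inv x\<close> lies in
    \<open>A \<inter> B\<close>, and the choice \<open>c = y\<close> makes both factors equal to
    \<open>\<one>\<close>.\<close>
  moreover have "\<one> \<in> carrier G - ?Z"
  proof -
    have "(x, y) \<in> P" if "x \<in> A" "y \<in> B" "\<one> = x \<otimes> y" for x y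
    proof -
      have xy: "x \<in> carrier G" "y \<in> carrier G" using that a(4) b(4) by auto
      then have "inv x = y" using that(3) inv_equality inv_comm by metis
      then have "y \<in> A" using that(1) subgroup.m_inv_closed[OF a(1)] by blast
      then have "y \<in> A \<inter> B" "x \<otimes> y \<in> W" "inv y \<otimes> y \<in> W" using that W(2) xy by auto
      then show ?thesis unfolding P_def using xy by (force simp: topspace_eq)
    qed
    then show ?thesis by auto
  qed
  moreover have "(A <#> B) \<inter> (carrier G - ?Z) \<subseteq> C"
  proof
    fix z assume z: "z \<in> (A <#> B) \<inter> (carrier G - ?Z)"
    then obtain x y where xy: "x \<in> A" "y \<in> B" "z = x \<otimes> y" by (auto simp: set_mult_def)
    have xyG: "x \<in> carrier G" "y \<in> carrier G" using xy a(4) b(4) by auto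
    have "(x, y) \<in> P" using z xy xyG by (auto simp: topspace_eq)
    then obtain c where c: "c \<in> A" "c \<in> B" "x \<otimes> c \<in> W" "inv c \<otimes> y \<in> W" by (auto simp: P_def)
    have "x \<otimes> c \<in> C" using c(1,3) xy(1) W(3) subgroup.m_closed[OF a(1)] by blast
    moreover have "inv c \<otimes> y \<in> C"
      using c(2,4) xy(2) W(4) subgroup.m_closed[OF b(1)] subgroup.m_inv_closed[OF b(1)] by blast
    ultimately have "(x \<otimes> c) \<otimes> (inv c \<otimes> y) \<in> C" using subgroup.m_closed[OF clnD(1)[OF C]] by blast
    moreover have "c \<in> carrier G" using c(1) a(4) by blast
    ultimately show "z \<in> C" using xy(3) xyG by (simp add: m_assoc cancel_left)
  qed
  ultimately show "cls (A <#> B) \<sqsubseteq>\<^bsub>LN\<^esub> \<gamma>"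
    unfolding \<gamma>C using le_cls_iff[OF AB C] by blast
qed

section \<open>Least upper bounds under conjugation\<close>

text \<open>Applying \<open>g\<close> to the assumed inequalities shows that \<open>g\<beta>\<close>
  is an upper bound of \<open>S\<close>, hence above the least one.\<close>

lemma le_conj_class_least:
  assumes \<beta>: "least LN \<beta> (Upper LN S)" and S: "S \<subseteq> carrier LN" and g: "g \<in> carrier G"
    and le: "\<And>s. s \<in> S \<Longrightarrow> conj_class G T (inv g) s \<sqsubseteq>\<^bsub>LN\<^esub> \<beta>"
  shows "\<beta> \<sqsubseteq>\<^bsub>LN\<^esub> conj_class G T g \<beta>"
proof (rule least_le[OF \<beta>])
  have \<beta>c: "\<beta> \<in> carrier LN" using least_closed[OF \<beta>] Upper_closed by blast
  show "conj_class G T g \<beta> \<in> Upper LN S"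
  proof (rule Upper_memI)
    fix s assume s: "s \<in> S"
    have "conj_class G T g (conj_class G T (inv g) s) \<sqsubseteq>\<^bsub>LN\<^esub> conj_class G T g \<beta>"
      using conj_class_mono[OF g _ \<beta>c le[OF s]] conj_class_carrier s S g by blast
    then show "s \<sqsubseteq>\<^bsub>LN\<^esub> conj_class G T g \<beta>"
      using conj_class_mult[of g "inv g" s] conj_class_one[of s] s S g by auto
  qed (rule conj_class_carrier[OF g \<beta>c])
qed

text \<open>Antisymmetry, from the preceding inequality for \<open>g\<close> and for
  \<open>inv g\<close>. Translates of members are only asked to stay below \<open>\<beta>\<close>:
  the compact open subgroup permutes \<open>S\<close>, but for elements of the chosen conjugates of
  \<open>H\<close> only this domination is established.\<close>

lemma conj_class_least_eq:
  assumes \<beta>: "least LN \<beta> (Upper LN S)" and S: "S \<subseteq> carrier LN" and g: "g \<in> carrier G"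
    and le: "\<And>s. s \<in> S \<Longrightarrow> conj_class G T g s \<sqsubseteq>\<^bsub>LN\<^esub> \<beta>"
      "\<And>s. s \<in> S \<Longrightarrow> conj_class G T (inv g) s \<sqsubseteq>\<^bsub>LN\<^esub> \<beta>"
  shows "conj_class G T g \<beta> = \<beta>"
proof -
  interpret partial_order LN by (rule partial_order_structure_lattice)
  have \<beta>c: "\<beta> \<in> carrier LN" using least_closed[OF \<beta>] Upper_closed by blast
  have "\<beta> \<sqsubseteq>\<^bsub>LN\<^esub> conj_class G T (inv g) \<beta>"
    using le_conj_class_least[OF \<beta> S, of "inv g"] g le(1) by simp
  then have "conj_class G T g \<beta> \<sqsubseteq>\<^bsub>LN\<^esub> conj_class G T g (conj_class G T (inv g) \<beta>)"
    by (intro conj_class_mono conj_class_carrier inv_closed g \<beta>c)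
  then have "conj_class G T g \<beta> \<sqsubseteq>\<^bsub>LN\<^esub> \<beta>"
    using conj_class_mult[of g "inv g" \<beta>] conj_class_one[of \<beta>] g \<beta>c by simp
  then show ?thesis
    using le_conj_class_least[OF \<beta> S g le(2)] conj_class_carrier[OF g \<beta>c] \<beta>c le_antisym by blast
qed

section \<open>Finite orbits, dense subgroups and finite generation\<close>

text \<open>Finitely many cosets of the open normaliser of a representative cover \<open>U\<close>,
  and the class is moved in the same way by all elements of one coset.\<close>

lemma finite_class_orbit:
  assumes U: "subgroup U G" "compactin T U" and \<beta>: "\<beta> \<in> carrier LN"
  shows "finite ((\<lambda>u. conj_class G T u \<beta>) ` U)"
proof -
  obtain K where K: "K \<in> cln" "\<beta> = cls K" using \<beta> mem_carrier_LN by blast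
  let ?N = "normalizer G K"
  have N: "subgroup ?N G" using normalizer_imp_subgroup[OF clnD(4)[OF K(1)]] .
  have "U \<subseteq> (\<Union>u\<in>U. u <#\<^bsub>G\<^esub> ?N)"
  proof
    fix u assume u: "u \<in> U"
    then have "u = u \<otimes> \<one>" using subgroup.mem_carrier[OF U(1)] by auto
    then show "u \<in> (\<Union>u\<in>U. u <#\<^bsub>G\<^esub> ?N)"
      using u subgroup.one_closed[OF N] by (auto simp: l_coset_def)
  qed
  then obtain F where F: "finite F" "F \<subseteq> U" "U \<subseteq> (\<Union>d\<in>F. d <#\<^bsub>G\<^esub> ?N)"
    using compactin_finite_l_cosets[OF U(2) clnD(3)[OF K(1)] subgroup.subset[OF U(1)]] by blast
  have "(\<lambda>u. conj_class G T u \<beta>) ` U \<subseteq> (\<lambda>u. conj_class G T u \<beta>) ` F"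
  proof (rule image_subsetI)
    fix u assume "u \<in> U"
    then obtain d n where d: "d \<in> F" "n \<in> ?N" "u = d \<otimes> n" using F(3) by (auto simp: l_coset_def)
    then have "conj_class G T u \<beta> = conj_class G T d \<beta>"
      using conj_class_mult[of d n \<beta>] conj_class_normalizer[OF K(1), of n] K(2) \<beta> F(2)
        subgroup.mem_carrier[OF U(1)] subgroup.mem_carrier[OF N] by auto
    then show "conj_class G T u \<beta> \<in> (\<lambda>u. conj_class G T u \<beta>) ` F" using d(1) by blast
  qed
  then show ?thesis using F(1) finite_surj by blast
qed

text \<open>Makes topological simplicity, which concerns closed normal subgroups, applicable to a
  normal closure. Each operation passes to the closure by continuity; for products, the closure of
  \<open>N \<times> N\<close> is the product of the closures.\<close>

lemma closure_of_normal_subgroup: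
  assumes "N \<lhd> G"
  shows "T closure_of N \<lhd> G"
proof -
  let ?C = "T closure_of N"
  have sub: "subgroup N G" using assms by (rule normal_imp_subgroup)
  have img: "f x \<in> ?C" if "continuous_map T T f" "f ` N \<subseteq> N" "x \<in> ?C" for f x
    using subset_trans[OF continuous_map_image_closure_subset[OF that(1)] closure_of_mono[OF that(2)]] that(3)
    by (rule subsetD[OF _ imageI])
  have "subgroup ?C G"
  proof (rule subgroupI)
    show "?C \<subseteq> carrier G" using closure_of_subset_topspace[of T N] topspace_eq by simp
    show "?C \<noteq> {}"
      using closure_of_subset[of N T] subgroup.one_closed[OF sub] subgroup.subset[OF sub] topspace_eq by blast
    fix x assume x: "x \<in> ?C"
    show "inv x \<in> ?C"
      using subgroup.m_inv_closed[OF sub] by (intro img[OF continuous_inv _ x] image_subsetI)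
    fix y assume y: "y \<in> ?C"
    have "(\<lambda>(x, y). x \<otimes> y) ` (N \<times> N) \<subseteq> N" using subgroup.m_closed[OF sub] by auto
    then have "(\<lambda>(x, y). x \<otimes> y) ` (prod_topology T T closure_of (N \<times> N)) \<subseteq> ?C"
      by (intro subset_trans[OF continuous_map_image_closure_subset[OF continuous_mult]] closure_of_mono)
    moreover have "(x, y) \<in> prod_topology T T closure_of (N \<times> N)"
      using x y by (simp add: closure_of_Times)
    ultimately show "x \<otimes> y \<in> ?C" by auto
  qed
  moreover have "g \<otimes> x \<otimes> inv g \<in> ?C" if "g \<in> carrier G" "x \<in> ?C" for g x
    using normal.inv_op_closed2[OF assms that(1)]
    by (intro img[OF continuous_conj[OF that(1)] _ that(2)] image_subsetI)
  ultimately show ?thesis by (auto simp: normal_inv_iff)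
qed

text \<open>The open coset of \<open>g\<close> meets \<open>D\<close> in some
  \<open>d = g \<otimes> u\<close>, so that \<open>g = d \<otimes> inv u\<close>.\<close>

lemma dense_l_cosets:
  assumes "subgroup D G" "T closure_of D = carrier G" and U: "subgroup U G" "openin T U"
  shows "carrier G \<subseteq> (\<Union>d\<in>D. d <#\<^bsub>G\<^esub> U)"
proof
  fix g assume g: "g \<in> carrier G"
  have "g \<otimes> \<one> \<in> g <#\<^bsub>G\<^esub> U" using subgroup.one_closed[OF U(1)] by (auto simp: l_coset_def)
  then have "g \<in> g <#\<^bsub>G\<^esub> U" using g by simp
  moreover have "g \<in> T closure_of D" using g assms(2) by simp
  ultimately obtain d where d: "d \<in> D" "d \<in> g <#\<^bsub>G\<^esub> U"
    using openin_l_coset[OF g U(2)] unfolding in_closure_of by blast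
  then obtain u where u: "u \<in> U" "d = g \<otimes> u" by (auto simp: l_coset_def)
  have "g = d \<otimes> inv u" using u g subgroup.mem_carrier[OF U(1) u(1)] by (simp add: m_assoc)
  then show "g \<in> (\<Union>d\<in>D. d <#\<^bsub>G\<^esub> U)"
    using d(1) subgroup.m_inv_closed[OF U(1) u(1)] by (auto simp: l_coset_def)
qed

text \<open>A word has finitely many letters, so it involves only finitely many of the sets
  \<open>A i\<close>.\<close>

lemma generate_UN_finite:
  assumes "x \<in> generate G (\<Union>i\<in>I. A i)"
  shows "\<exists>E. finite E \<and> E \<subseteq> I \<and> x \<in> generate G (\<Union>i\<in>E. A i)"
  using assms
proof induction
  case one
  then show ?case by (intro exI[of _ "{}"]) (auto intro: generate.one)
next
  case (incl h)
  then obtain i where "i \<in> I" "h \<in> A i" by blast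
  then show ?case by (intro exI[of _ "{i}"]) (auto intro: generate.incl)
next
  case (inv h)
  then obtain i where "i \<in> I" "h \<in> A i" by blast
  then show ?case by (intro exI[of _ "{i}"]) (auto intro: generate.inv)
next
  case (eng h1 h2)
  then obtain E F where EF: "finite E" "E \<subseteq> I" "h1 \<in> generate G (\<Union>i\<in>E. A i)"
    "finite F" "F \<subseteq> I" "h2 \<in> generate G (\<Union>i\<in>F. A i)" by blast
  have "h1 \<in> generate G (\<Union>i\<in>E \<union> F. A i)" "h2 \<in> generate G (\<Union>i\<in>E \<union> F. A i)"
    by (rule subsetD[OF mono_generate EF(3)], blast) (rule subsetD[OF mono_generate EF(6)], blast)
  then show ?case using EF generate.eng by (intro exI[of _ "E \<union> F"]) auto
qed

end

section \<open>Compact open subgroups, existence of joins, and the invariant join\<close>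

context tdlc_group
begin

text \<open>A compact open neighbourhood \<open>C\<close> of \<open>\<one>\<close> inside
  \<open>W\<close> is stable under right multiplication by a small symmetric neighbourhood
  \<open>S\<close> of \<open>\<one>\<close>. The subgroup generated by \<open>S\<close> therefore
  maps \<open>\<one>\<close> into \<open>C\<close>, so it lies in \<open>C\<close>; it is open,
  hence closed, hence compact.\<close>

lemma van_Dantzig_compact_open_subgroup:
  assumes W: "openin T W" "\<one> \<in> W"
  obtains V where "subgroup V G" "openin T V" "compactin T V" "V \<subseteq> W"
proof -
  obtain N L where NL: "openin T N" "compactin T L" "\<one> \<in> N" "N \<subseteq> L"
    using locally_compact topspace_eq unfolding locally_compact_space_def by (metis one_closed)
  have "{\<one>} \<in> connected_components_of T"
    using totally_disconnected[OF one_closed] one_closed topspace_eq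
    unfolding connected_components_of_def by (metis imageI)
  \<comment> \<open>The component \<open>{\<one>}\<close> is compact, so it can be separated by a
    clopen set inside \<open>N \<inter> W\<close>.\<close>
  then obtain C C' where C: "openin T C" "openin T C'" "disjnt C C'" "C \<union> C' = topspace T"
      "{\<one>} \<subseteq> C" "C \<subseteq> N \<inter> W"
    by (rule wilder_locally_compact_component_thm[OF locally_compact Hausdorff, of "{\<one>}" "N \<inter> W"])
      (use NL W topspace_eq in auto)
  have "closedin T C"
  proof -
    have "topspace T - C = C'" using C(3,4) by (auto simp: disjnt_iff)
    then show ?thesis using C(1,2) openin_subset by (simp add: closedin_def)
  qed
  then have compC: "compactin T C" using closed_compactin[OF NL(2)] C(6) NL(4) by blast
  let ?P = "{p \<in> topspace (prod_topology T T). (\<lambda>(x, y). x \<otimes> y) p \<in> C}"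
  have "openin (prod_topology T T) ?P"
    by (rule openin_continuous_map_preimage[OF continuous_mult C(1)])
  moreover have CG: "C \<subseteq> carrier G" using C(1) openin_subset topspace_eq by metis
  then have "C \<times> {\<one>} \<subseteq> ?P" by (auto simp: topspace_eq)
  \<comment> \<open>The tube lemma, with \<open>C\<close> compact, gives one \<open>B\<close> that
    works for all points of \<open>C\<close> at once.\<close>
  ultimately obtain A B where AB: "openin T A" "openin T B" "C \<subseteq> A" "\<one> \<in> B" "A \<times> B \<subseteq> ?P"
    using tube_lemma_left[OF _ compC, of T ?P "\<one>"] topspace_eq by auto
  \<comment> \<open>Symmetrised so that both the generators and their inverses lie in
    \<open>B\<close>.\<close>
  define S where "S = B \<inter> {x \<in> carrier G. inv x \<in> B}"
  have S: "openin T S" "\<one> \<in> S" "S \<subseteq> carrier G"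
    using AB openin_preimage[OF continuous_inv] by (auto simp: S_def)
  have CS: "x \<otimes> y \<in> C" if "x \<in> C" "y \<in> B" for x y 
  proof -
    have "(x, y) \<in> ?P" using AB(3,5) that by blast
    then show ?thesis by simp
  qed
  have gen: "\<forall>x\<in>C. x \<otimes> y \<in> C" if "y \<in> generate G S" for y
    using that
  proof induction
    case one
    then show ?case using CG by auto
  next
    case (eng h1 h2)
    show ?case
    proof
      fix x assume x: "x \<in> C"
      have "h1 \<in> carrier G" "h2 \<in> carrier G" using eng(1,2) generate_in_carrier[OF S(3)] by auto
      then have "x \<otimes> (h1 \<otimes> h2) = x \<otimes> h1 \<otimes> h2" using x CG by (simp add: m_assoc subset_eq)
      then show "x \<otimes> (h1 \<otimes> h2) \<in> C" using eng(3,4) x by simp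
    qed
  qed (auto simp: S_def intro: CS)
  let ?V = "generate G S"
  have VC: "?V \<subseteq> C"
  proof
    fix y assume y: "y \<in> ?V"
    then have "\<one> \<otimes> y \<in> C" using gen C(5) by blast
    then show "y \<in> C" using generate_in_carrier[OF S(3) y] by simp
  qed
  have sub: "subgroup ?V G" using S(3) by (rule generate_is_subgroup)
  have op: "openin T ?V" using openin_subgroup_nhd[OF sub S(1) _ S(2)] by (blast intro: generate.incl)
  show thesis
  proof (rule that)
    show "compactin T ?V" using closed_compactin[OF compC VC closedin_open_subgroup[OF sub op]] .
  qed (use sub op VC C(6) in auto)
qed

text \<open>Intersecting both representatives with a compact open subgroup inside their normalisers
  leaves the classes unchanged and makes their product a representative of the join.\<close>

lemma upper_semilattice_structure_lattice: "upper_semilattice LN"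
proof -
  interpret partial_order LN by (rule partial_order_structure_lattice)
  show ?thesis
  proof unfold_locales
    fix \<alpha> \<beta> assume "\<alpha> \<in> carrier LN" "\<beta> \<in> carrier LN"
    then obtain H K where H: "H \<in> cln" "\<alpha> = cls H" and K: "K \<in> cln" "\<beta> = cls K"
      by (auto simp: mem_carrier_LN)
    note h = clnD[OF H(1)] and k = clnD[OF K(1)]
    obtain V where V: "subgroup V G" "openin T V" "compactin T V" "V \<subseteq> normalizer G H \<inter> normalizer G K"
    proof (rule van_Dantzig_compact_open_subgroup)
      show "openin T (normalizer G H \<inter> normalizer G K)" using h(3) k(3) by blast
      show "\<one> \<in> normalizer G H \<inter> normalizer G K"
        using h(4) k(4) by (simp add: mem_normalizer_iff conj_subset_one)
    qed
    \<comment> \<open>\<open>V\<close> normalises both \<open>H\<close> and itself, hence also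
      \<open>H \<inter> V\<close>.\<close>
    have "K \<inter> V \<subseteq> normalizer G (H \<inter> V)"
      using V(4) subgroup_subset_normalizer[OF V(1)] normalizer_Int[OF h(4) subgroup.subset[OF V(1)]]
      by blast
    moreover have "compactin T (H \<inter> V)" "compactin T (K \<inter> V)"
      using V(3) h(2) k(2) by (auto intro: closed_Int_compactin)
    ultimately have "least LN (cls ((H \<inter> V) <#> (K \<inter> V))) (Upper LN {cls (H \<inter> V), cls (K \<inter> V)})"
      using least_set_mult cls_Int_open_subgroup(1) H(1) K(1) V Hausdorff by blast
    then show "\<exists>s. least LN s (Upper LN {\<alpha>, \<beta>})"
      using cls_Int_open_subgroup(2)[OF H(1) V(1,2)] cls_Int_open_subgroup(2)[OF K(1) V(1,2)] H(2) K(2)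
      by auto
  qed
qed

text \<open>Simplicity enters only through the density hypothesis. The join is taken over a finite
  set of classes; conjugating elements are listed only in the final theorem.\<close>

lemma exists_invariant_join:
  assumes cg: "compactly_generated G T" and H: "H \<in> cln"
    and dense: "T closure_of (generate G (\<Union>g\<in>carrier G. conj_subset G g H)) = carrier G"
  shows "\<exists>S. finite S \<and> S \<noteq> {} \<and> S \<subseteq> (\<lambda>g. conj_class G T g (cls H)) ` carrier G \<and>
    (\<forall>g\<in>carrier G. conj_class G T g (\<Squnion>\<^bsub>LN\<^esub> S) = \<Squnion>\<^bsub>LN\<^esub> S)"
proof -
  interpret L: upper_semilattice LN by (rule upper_semilattice_structure_lattice)
  let ?D = "generate G (\<Union>g\<in>carrier G. conj_subset G g H)"
  have H': "(\<Union>g\<in>carrier G. conj_subset G g H) \<subseteq> carrier G"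
    using conj_subset_closed clnD(4)[OF H] by blast
  have \<alpha>: "cls H \<in> carrier LN" using H by (rule cls_carrier)
  obtain U where U: "subgroup U G" "openin T U" "compactin T U"
    using van_Dantzig_compact_open_subgroup[of "carrier G"] openin_topspace[of T] topspace_eq one_closed by metis
  obtain C where C: "compactin T C" "generate G C = carrier G"
    using cg by (auto simp: compactly_generated_def)
  have subD: "subgroup ?D G" using H' by (rule generate_is_subgroup)
  have "C \<subseteq> (\<Union>d\<in>?D. d <#\<^bsub>G\<^esub> U)"
    using dense_l_cosets[OF subD dense U(1,2)] compactin_subset_topspace[OF C(1)] topspace_eq by blast
  then obtain F where F: "finite F" "F \<subseteq> ?D" "C \<subseteq> (\<Union>d\<in>F. d <#\<^bsub>G\<^esub> U)"
    using compactin_finite_l_cosets[OF C(1) U(2) subgroup.subset[OF subD]] by blast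
  have "\<forall>d\<in>F. \<exists>E. finite E \<and> E \<subseteq> carrier G \<and> d \<in> generate G (\<Union>g\<in>E. conj_subset G g H)"
    using F(2) generate_UN_finite by blast
  then obtain E where E: "\<And>d. d \<in> F \<Longrightarrow> finite (E d) \<and> E d \<subseteq> carrier G \<and>
      d \<in> generate G (\<Union>g\<in>E d. conj_subset G g H)"
    by metis
  \<comment> \<open>\<open>F1\<close> collects the conjugators occurring in words for the elements
    of \<open>F\<close>; inserting \<open>\<one>\<close> keeps \<open>S\<close> nonempty whatever
    \<open>F\<close> is.\<close>
  define F1 where "F1 = insert \<one> (\<Union>d\<in>F. E d)"
  have F1: "finite F1" "F1 \<subseteq> carrier G" using F(1) E by (auto simp: F1_def)
  have F1c: "conj_class G T f (cls H) \<in> carrier LN" if "f \<in> F1" for f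
    using that F1(2) by (intro conj_class_carrier[OF _ \<alpha>]) blast
  \<comment> \<open>The union of the \<open>U\<close>-orbits of the chosen conjugate classes: finite
    because \<open>U\<close> is compact, and permuted by \<open>U\<close>.\<close>
  define S where "S = (\<Union>f\<in>F1. (\<lambda>u. conj_class G T u (conj_class G T f (cls H))) ` U)"
  have UG: "U \<subseteq> carrier G" using U(1) by (rule subgroup.subset)
  have Sc: "S \<subseteq> carrier LN"
    unfolding S_def using UG by (intro UN_least image_subsetI conj_class_carrier F1c) blast
  have finS: "finite S" unfolding S_def
    by (intro finite_UN_I F1(1) finite_class_orbit[OF U(1,3)] F1c)
  have SI: "conj_class G T u (conj_class G T f (cls H)) \<in> S" if "f \<in> F1" "u \<in> U" for f u
    unfolding S_def using that by blast
  have SU: "conj_class G T u s \<in> S" if u: "u \<in> U" and s: "s \<in> S" for u s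
  proof -
    obtain f v where f: "f \<in> F1" "v \<in> U" "s = conj_class G T v (conj_class G T f (cls H))"
      using s by (auto simp: S_def)
    then have "conj_class G T u s = conj_class G T (u \<otimes> v) (conj_class G T f (cls H))"
      using u UG by (subst conj_class_mult[OF _ _ F1c]) auto
    then show ?thesis using SI[OF f(1) subgroup.m_closed[OF U(1) u f(2)]] by simp
  qed
  have SF: "conj_class G T f (cls H) \<in> S" if "f \<in> F1" for f
    using SI[OF that subgroup.one_closed[OF U(1)]] conj_class_one[OF F1c[OF that]] by simp
  then have neS: "S \<noteq> {}" by (auto simp: F1_def)
  define \<beta> where "\<beta> = \<Squnion>\<^bsub>LN\<^esub> S"
  have least: "least LN \<beta> (Upper LN S)" unfolding \<beta>_def by (rule L.finite_sup_least[OF finS Sc neS])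
  have \<beta>: "\<beta> \<in> carrier LN" using least_closed[OF least] Upper_closed by blast
  have le: "s \<sqsubseteq>\<^bsub>LN\<^esub> \<beta>" if "s \<in> S" for s
    using least_mem[OF least] that Sc by (auto simp: Upper_def)
  obtain B where B: "B \<in> cln" "\<beta> = cls B" using \<beta> by (auto simp: mem_carrier_LN)
  let ?Stab = "{g \<in> carrier G. conj_class G T g \<beta> = \<beta>}"
  have Stab: "subgroup ?Stab G" using \<beta> by (rule subgroup_stabilizer_class)
  have UStab: "U \<subseteq> ?Stab"
  proof
    fix u assume u: "u \<in> U"
    have "conj_class G T u \<beta> = \<beta>"
      using u UG subgroup.m_inv_closed[OF U(1) u] by (intro conj_class_least_eq[OF least Sc] le SU) auto
    then show "u \<in> ?Stab" using u UG by blast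
  qed
  have HStab: "conj_subset G f H \<subseteq> ?Stab" if f: "f \<in> F1" for f
  proof
    let ?K = "conj_subset G f H"
    have fG: "f \<in> carrier G" using f F1(2) by blast
    have K: "?K \<in> cln" using fG H by (rule conj_subset_closed_locally_normal)
    have KB: "cls ?K \<sqsubseteq>\<^bsub>LN\<^esub> cls B" using le[OF SF[OF f]] conj_class_eq[OF fG H] B(2) by simp
    have *: "conj_class G T k s \<sqsubseteq>\<^bsub>LN\<^esub> \<beta>" if k: "k \<in> ?K" and s: "s \<in> S" for k s
    proof -
      obtain M where M: "M \<in> cln" "s = cls M" using subsetD[OF Sc s] unfolding mem_carrier_LN by blast
      show ?thesis
        using conj_class_le_upper_bound[OF K M(1) B(1) KB _ k] le[OF s] unfolding M(2) B(2) by blast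
    qed
    fix k assume k: "k \<in> ?K"
    have "inv k \<in> ?K" using subgroup.m_inv_closed[OF clnD(1)[OF K] k] .
    then have "conj_class G T k \<beta> = \<beta>"
      using k clnD(4)[OF K] by (intro conj_class_least_eq[OF least Sc] *) auto
    then show "k \<in> ?Stab" using k clnD(4)[OF K] by blast
  qed
  \<comment> \<open>Each \<open>c\<close> in \<open>C\<close> is \<open>d \<otimes> u\<close> with
    \<open>d\<close> a word in the chosen conjugates and \<open>u\<close> in \<open>U\<close>, and
    both factors fix \<open>\<beta>\<close>. Since \<open>C\<close> generates \<open>G\<close>, so
    does the stabiliser.\<close>
  have "C \<subseteq> ?Stab"
  proof
    fix c assume "c \<in> C"
    then obtain d u where d: "d \<in> F" "u \<in> U" "c = d \<otimes> u" using F(3) by (auto simp: l_coset_def)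
    have "(\<Union>g\<in>E d. conj_subset G g H) \<subseteq> ?Stab" using HStab d(1) unfolding F1_def by blast
    then have "d \<in> ?Stab" using E[OF d(1)] generate_subgroup_incl[OF _ Stab] by blast
    then show "c \<in> ?Stab" unfolding d(3) using subsetD[OF UStab d(2)] by (rule subgroup.m_closed[OF Stab])
  qed
  from generate_subgroup_incl[OF this Stab] have "carrier G \<subseteq> ?Stab" unfolding C(2) .
  then have "conj_class G T g \<beta> = \<beta>" if "g \<in> carrier G" for g using that by blast
  moreover have "S \<subseteq> (\<lambda>g. conj_class G T g (cls H)) ` carrier G"
  proof
    fix s assume "s \<in> S"
    then obtain f v where f: "f \<in> F1" "v \<in> U" "s = conj_class G T v (conj_class G T f (cls H))"
      by (auto simp: S_def)
    then have "v \<in> carrier G" "f \<in> carrier G" using UG F1(2) by auto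
    then show "s \<in> (\<lambda>g. conj_class G T g (cls H)) ` carrier G"
      using conj_class_mult[OF _ _ \<alpha>] unfolding f(3) by (intro image_eqI[of _ _ "v \<otimes> f"]) simp_all
  qed
  ultimately show ?thesis unfolding \<beta>_def using finS neS by blast
qed

text \<open>The closure of the normal closure is a closed normal subgroup containing
  \<open>h \<noteq> \<one>\<close>, so simplicity leaves only \<open>G\<close>.\<close>

lemma dense_normal_closure:
  assumes simple: "topologically_simple G T" and H: "H \<subseteq> carrier G" "h \<in> H" "h \<noteq> \<one>"
  shows "T closure_of (generate G (\<Union>g\<in>carrier G. conj_subset G g H)) = carrier G"
proof -
  let ?A = "\<Union>g\<in>carrier G. conj_subset G g H"
  have A: "?A \<subseteq> carrier G" using conj_subset_closed H(1) by blast
  have "generate G ?A \<lhd> G"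
  proof (rule normal_generateI[OF A])
    fix x g assume x: "x \<in> ?A" and g: "g \<in> carrier G"
    then obtain k where "k \<in> carrier G" "x \<in> conj_subset G k H" by blast
    then have "g \<otimes> x \<otimes> inv g \<in> conj_subset G (g \<otimes> k) H"
      using conj_subset_conj_subset[OF g _ H(1), of k] conj_subset_eq_image by blast
    then show "g \<otimes> x \<otimes> inv g \<in> ?A" using g \<open>k \<in> carrier G\<close> by blast
  qed
  then have "T closure_of (generate G ?A) \<lhd> G" by (rule closure_of_normal_subgroup)
  moreover have "h \<in> T closure_of (generate G ?A)"
  proof -
    have "h \<in> conj_subset G \<one> H" using conj_subset_one[OF H(1)] H(2) by simp
    then have "h \<in> generate G ?A" by (blast intro: generate.incl)
    moreover have "generate G ?A \<subseteq> T closure_of (generate G ?A)"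
      by (rule closure_of_subset) (simp add: topspace_eq generate_incl[OF A])
    ultimately show ?thesis by blast
  qed
  ultimately show ?thesis
    using simple H(3) closedin_closure_of[of T "generate G ?A"] unfolding topologically_simple_def by auto
qed

end

section \<open>The trivial case and the enumeration of conjugators\<close>

theorem theorem3:
  fixes G :: "('a, 'b) monoid_scheme" and T :: "'a topology" and \<alpha> :: "'a set set"
  assumes "class_S G T"
    and "\<alpha> \<in> carrier (structure_lattice G T)"
  shows "\<exists>(n::nat) g. n \<ge> 1 \<and> (\<forall>i\<in>{1..n}. g i \<in> carrier G) \<and>
    (\<forall>h\<in>carrier G.
      conj_class G T h (\<Squnion>\<^bsub>structure_lattice G T\<^esub> ((\<lambda>i. conj_class G T (g i) \<alpha>) ` {1..n}))
      = \<Squnion>\<^bsub>structure_lattice G T\<^esub> ((\<lambda>i. conj_class G T (g i) \<alpha>) ` {1..n}))"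
proof -
  let ?L = "structure_lattice G T"
  interpret tdlc_group G T using assms(1) by (simp add: class_S_def)
  have cg: "compactly_generated G T" and simple: "topologically_simple G T"
    using assms(1) by (auto simp: class_S_def)
  obtain H where H: "H \<in> closed_locally_normal G T" "\<alpha> = loc_equiv G T `` {H}"
    using assms(2) mem_carrier_LN by blast
  have "\<exists>S. finite S \<and> S \<noteq> {} \<and> S \<subseteq> (\<lambda>g. conj_class G T g \<alpha>) ` carrier G \<and>
    (\<forall>g\<in>carrier G. conj_class G T g (\<Squnion>\<^bsub>?L\<^esub> S) = \<Squnion>\<^bsub>?L\<^esub> S)"
  \<comment> \<open>A trivial \<open>H\<close> has a trivial normal closure, which cannot serve as
    the dense subgroup. In that case every element of \<open>G\<close> fixes
    \<open>\<alpha>\<close>, and \<open>S = {\<alpha>}\<close> works.\<close>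
  proof (cases "H = {\<one>\<^bsub>G\<^esub>}")
    case True
    interpret L: upper_semilattice ?L by (rule upper_semilattice_structure_lattice)
    have triv: "conj_class G T g \<alpha> = \<alpha>" if "g \<in> carrier G" for g
      using conj_class_eq[OF that H(1)] that True H(2) by (simp add: conj_subset_eq_image)
    \<comment> \<open>The join of \<open>{\<alpha>}\<close> is not computed; its being a least upper
      bound is enough for \<open>conj_class_least_eq\<close>.\<close>
    have least: "least ?L (\<Squnion>\<^bsub>?L\<^esub> {\<alpha>}) (Upper ?L {\<alpha>})"
      by (rule L.finite_sup_least) (use assms(2) in auto)
    have "\<alpha> \<sqsubseteq>\<^bsub>?L\<^esub> \<Squnion>\<^bsub>?L\<^esub> {\<alpha>}" using least_mem[OF least] assms(2) by (auto simp: Upper_def)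
    then have "conj_class G T g (\<Squnion>\<^bsub>?L\<^esub> {\<alpha>}) = \<Squnion>\<^bsub>?L\<^esub> {\<alpha>}" if "g \<in> carrier G" for g
      using conj_class_least_eq[OF least _ that] assms(2) triv that by simp
    moreover have "{\<alpha>} \<subseteq> (\<lambda>g. conj_class G T g \<alpha>) ` carrier G" using triv by force
    ultimately show ?thesis by (intro exI[of _ "{\<alpha>}"]) simp
  next
    case False
    then obtain h where "h \<in> H" "h \<noteq> \<one>\<^bsub>G\<^esub>"
      using subgroup.one_closed[OF clnD(1)[OF H(1)]] by blast
    then have "T closure_of (generate G (\<Union>g\<in>carrier G. conj_subset G g H)) = carrier G"
      by (rule dense_normal_closure[OF simple clnD(4)[OF H(1)]])
    then show ?thesis unfolding H(2) by (rule exists_invariant_join[OF cg H(1)])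
  qed
  then obtain S where S: "finite S" "S \<noteq> {}" "S \<subseteq> (\<lambda>g. conj_class G T g \<alpha>) ` carrier G"
    and fixed: "\<And>g. g \<in> carrier G \<Longrightarrow> conj_class G T g (\<Squnion>\<^bsub>?L\<^esub> S) = \<Squnion>\<^bsub>?L\<^esub> S"
    by auto
  obtain F where F: "finite F" "F \<subseteq> carrier G" "S = (\<lambda>g. conj_class G T g \<alpha>) ` F"
    using finite_subset_image[OF S(1,3)] by blast
  \<comment> \<open>Enumeration starts at 1 to match \<open>{1..n}\<close> with
    \<open>n = card F\<close>, which is positive because \<open>S\<close> is nonempty.\<close>
  obtain g where "bij_betw g {1..card F} F" using ex_bij_betw_nat_finite_1[OF F(1)] by blast
  then have g: "g ` {1..card F} = F" by (rule bij_betw_imp_surj_on)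
  have "S = (\<lambda>g. conj_class G T g \<alpha>) ` g ` {1..card F}" unfolding g by (rule F(3))
  then have img: "(\<lambda>i. conj_class G T (g i) \<alpha>) ` {1..card F} = S" by (simp add: image_image)
  show ?thesis
  proof (intro exI conjI ballI)
    show "1 \<le> card F" using F S(2) card_gt_0_iff[of F] by auto
    show "g i \<in> carrier G" if "i \<in> {1..card F}" for i using g F(2) that by blast
    show "conj_class G T h (\<Squnion>\<^bsub>?L\<^esub> ((\<lambda>i. conj_class G T (g i) \<alpha>) ` {1..card F}))
      = \<Squnion>\<^bsub>?L\<^esub> ((\<lambda>i. conj_class G T (g i) \<alpha>) ` {1..card F})" if "h \<in> carrier G" for h
      unfolding img using that by (rule fixed)
  qed
qed

end
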